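(* For $r\ge0$ let $v_r(n)$ be the number of permutations of $[n]$ containing exactly $r$ occurrences of the pattern $23\text{-}1$, and $V_r(x)=\sum_{n\ge0}v_r(n)x^n$. Then, as formal power series, $$V_2(x)=\frac{x}{1-x}\left(V_2\Bigl(\frac{x}{1-x}\Bigr)+(1-2x)V_1\Bigl(\frac{x}{1-x}\Bigr)+(1-3x+x^2)V_0\Bigl(\frac{x}{1-x}\Bigr)\right)-x+x^2.$$
   Context: An occurrence of the pattern $23\text{-}1$ in a permutation $a_1a_2\cdots a_n$ is a pair of indices $(i,j)$ with $1\le i$, $i+1<j\le n$, such that $a_j<a_i<a_{i+1}$. The empty permutation (n=0) has no occurrences, so $v_0(0)=1$. *)

theory Defs
  imports "HOL-Computational_Algebra.Formal_Power_Series" "HOL-Combinatorics.Permutations"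
begin

text \<open>A permutation \<open>a\<^sub>1 \<dots> a\<^sub>n\<close> of \<open>{1..n}\<close> is a function \<open>a\<close> with \<open>a permutes {1..n}\<close>;
  its word is \<open>a 1, \<dots>, a n\<close>.\<close>

definition occ_23_1 :: "nat \<Rightarrow> (nat \<Rightarrow> nat) \<Rightarrow> (nat \<times> nat) set" where
  "occ_23_1 n a = {(i, j). 1 \<le> i \<and> i + 1 < j \<and> j \<le> n \<and> a j < a i \<and> a i < a (i + 1)}"

definition v :: "nat \<Rightarrow> nat \<Rightarrow> nat" where
  "v r n = card {a. a permutes {1..n} \<and> card (occ_23_1 n a) = r}"

definition V :: "nat \<Rightarrow> rat fps" where
  "V r = Abs_fps (\<lambda>n. of_nat (v r n))"

end

theory Submission
  imports Defs
begin

text \<open>Deleting the first letter \<open>a + 1\<close> of a permutation removes no occurrence if a descent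
  follows, and exactly \<open>a\<close> occurrences if an ascent follows, since then all smaller letters stand
  further right. So, letting \<open>w r n a\<close> count by the first letter as well, for \<open>a > 2\<close> only the
  descents contribute to \<open>w 2 (n + 1) a\<close>, and the partial sums of \<open>w 2 n\<close> obey Pascal's recursion
  with source terms at \<open>a = 0, 1, 2\<close>. Solving it gives a binomial transform, which on generating
  functions is the substitution \<open>x / (1 - x)\<close>.\<close>

section \<open>Deleting the first letter\<close>

text \<open>The first letter is \<open>Suc a\<close> so that \<open>a\<close> is the number of
  smaller letters, hence the number of occurrences that an ascent at the start creates.\<close>

definition w :: "nat \<Rightarrow> nat \<Rightarrow> nat \<Rightarrow> nat" where
  "w r n a = card {p. p permutes {1..n} \<and> card (occ_23_1 n p) = r \<and> p 1 = Suc a}"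

text \<open>The order isomorphism onto the naturals other than \<open>Suc a\<close>: it makes room
  for a new letter without changing any pattern.\<close>

definition skip :: "nat \<Rightarrow> nat \<Rightarrow> nat" where
  "skip a x = (if x \<le> a then x else Suc x)"

definition unskip :: "nat \<Rightarrow> nat \<Rightarrow> nat" where
  "unskip a x = (if x \<le> a then x else x - 1)"

definition prepend :: "nat \<Rightarrow> nat \<Rightarrow> (nat \<Rightarrow> nat) \<Rightarrow> nat \<Rightarrow> nat" where
  "prepend n a q i =
    (if i = 1 then Suc a else if 2 \<le> i \<and> i \<le> Suc n then skip a (q (i - 1)) else i)"

definition delete_first :: "nat \<Rightarrow> nat \<Rightarrow> (nat \<Rightarrow> nat) \<Rightarrow> nat \<Rightarrow> nat" where
  "delete_first n a p i = (if 1 \<le> i \<and> i \<le> n then unskip a (p (Suc i)) else i)"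

lemma unskip_skip [simp]: "unskip a (skip a x) = x"
  by (simp add: skip_def unskip_def)

lemma skip_unskip: "x \<noteq> Suc a \<Longrightarrow> skip a (unskip a x) = x"
  by (auto simp: skip_def unskip_def)

lemma skip_less_iff [simp]: "skip a x < skip a y \<longleftrightarrow> x < y"
  by (auto simp: skip_def)

lemma skip_eq_iff [simp]: "skip a x = skip a y \<longleftrightarrow> x = y"
  by (auto simp: skip_def)

lemma inj_on_imp_permutes_atLeastAtMost:
  assumes "inj_on f {1..n}" "\<And>i. i \<in> {1..n} \<Longrightarrow> f i \<in> {1..n}" "\<And>i. i \<notin> {1..n} \<Longrightarrow> f i = i"
  shows "f permutes {1..n::nat}"
proof (rule bij_imp_permutes)
  show "bij_betw f {1..n} {1..n}"
    unfolding bij_betw_def using assms endo_inj_surj[of "{1..n}" f] by (simp add: image_subset_iff)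
qed (use assms in auto)

lemma prepend_permutes:
  assumes q: "q permutes {1..n}" and a: "a \<le> n"
  shows "prepend n a q permutes {1..Suc n}"
proof (rule inj_on_imp_permutes_atLeastAtMost)
  have inj: "q x = q y \<longleftrightarrow> x = y" for x y
    using permutes_inj[OF q] by (auto dest: injD)
  have mem: "1 \<le> q x \<and> q x \<le> n" if "1 \<le> x" "x \<le> n" for x
    using permutes_in_image[OF q, of x] that by auto
  have ne: "skip a x \<noteq> Suc a" for x
    by (auto simp: skip_def)
  show "inj_on (prepend n a q) {1..Suc n}"
    by (intro inj_onI) (auto simp: prepend_def ne ne[symmetric] inj split: if_splits)
  show "prepend n a q i \<in> {1..Suc n}" if "i \<in> {1..Suc n}" for i
    using that a mem[of "i - 1"] by (auto simp: prepend_def skip_def)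
  show "prepend n a q i = i" if "i \<notin> {1..Suc n}" for i
    using that by (auto simp: prepend_def)
qed

lemma delete_first_permutes:
  assumes p: "p permutes {1..Suc n}" and p1: "p 1 = Suc a"
  shows "delete_first n a p permutes {1..n}"
proof (rule inj_on_imp_permutes_atLeastAtMost)
  have inj: "p x = p y \<longleftrightarrow> x = y" for x y
    using permutes_inj[OF p] by (auto dest: injD)
  have ne: "p (Suc x) \<noteq> Suc a" if "1 \<le> x" for x
    using inj[of "Suc x" 1] p1 that by auto
  have mem: "1 \<le> p x \<and> p x \<le> Suc n" if "1 \<le> x" "x \<le> Suc n" for x
    using permutes_in_image[OF p, of x] that by auto
  have a: "a \<le> n"
    using mem[of 1] p1 by auto
  show "inj_on (delete_first n a p) {1..n}"
  proof (rule inj_onI)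
    fix x y assume xy: "x \<in> {1..n}" "y \<in> {1..n}" "delete_first n a p x = delete_first n a p y"
    then have "unskip a (p (Suc x)) = unskip a (p (Suc y))"
      by (simp add: delete_first_def)
    then have "p (Suc x) = p (Suc y)"
      using skip_unskip[of "p (Suc x)" a] skip_unskip[of "p (Suc y)" a] ne xy
      by (metis atLeastAtMost_iff)
    then show "x = y"
      by (simp add: inj)
  qed
  show "delete_first n a p i \<in> {1..n}" if "i \<in> {1..n}" for i
    using that a mem[of "Suc i"] ne[of i] by (auto simp: delete_first_def unskip_def)
  show "delete_first n a p i = i" if "i \<notin> {1..n}" for i
    using that by (auto simp: delete_first_def)
qed

lemma bij_betw_prepend:
  assumes a: "a \<le> n"
  shows "bij_betw (prepend n a) {q. q permutes {1..n}} {p. p permutes {1..Suc n} \<and> p 1 = Suc a}"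
proof (rule bij_betw_byWitness[where f' = "delete_first n a"])
  have "delete_first n a (prepend n a q) = q" if "q permutes {1..n}" for q
  proof
    fix i show "delete_first n a (prepend n a q) i = q i"
      using permutes_not_in[OF that, of i] by (auto simp: delete_first_def prepend_def)
  qed
  then show "\<forall>q\<in>{q. q permutes {1..n}}. delete_first n a (prepend n a q) = q"
    by blast
  have "prepend n a (delete_first n a p) = p" if p: "p permutes {1..Suc n}" and p1: "p 1 = Suc a" for p
  proof
    fix i
    consider "i = 1" | "i \<notin> {1..Suc n}" | "2 \<le> i" "i \<le> Suc n" by fastforce
    then show "prepend n a (delete_first n a p) i = p i"
    proof cases
      case 3
      then have "p i \<noteq> Suc a"
        using permutes_inj[OF p] p1 by (metis Suc_1 injD not_less_eq_eq order_refl)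
      with 3 show ?thesis
        by (auto simp: prepend_def delete_first_def skip_unskip)
    qed (use p1 permutes_not_in[OF p, of i] in \<open>auto simp: prepend_def\<close>)
  qed
  then show "\<forall>p\<in>{p. p permutes {1..Suc n} \<and> p 1 = Suc a}. prepend n a (delete_first n a p) = p"
    by blast
  show "prepend n a ` {q. q permutes {1..n}} \<subseteq> {p. p permutes {1..Suc n} \<and> p 1 = Suc a}"
    using prepend_permutes[OF _ a] by (auto simp: prepend_def)
  show "delete_first n a ` {p. p permutes {1..Suc n} \<and> p 1 = Suc a} \<subseteq> {q. q permutes {1..n}}"
    using delete_first_permutes by auto
qed

section \<open>Effect of a new first letter on the occurrences\<close>

lemma finite_occ_23_1: "finite (occ_23_1 n p)"
  by (rule finite_subset[of _ "{0..n} \<times> {0..n}"]) (auto simp: occ_23_1_def)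

text \<open>Since \<open>skip a\<close> preserves order, old occurrences merely move one place
  right. A new one starts at position 1, so it needs an ascent there and a later letter below
  \<open>Suc a\<close>.\<close>

lemma occ_23_1_prepend:
  assumes n: "1 \<le> n"
  shows "occ_23_1 (Suc n) (prepend n a q) =
    (\<lambda>(i, j). (Suc i, Suc j)) ` occ_23_1 n q \<union>
    (if a < q 1 then {1} \<times> (Suc ` {j \<in> {2..n}. q j \<le> a}) else {})" (is "?L = ?R")
proof -
  have "(i, j) \<in> ?L \<longleftrightarrow> (i, j) \<in> ?R" for i j
  proof (cases "2 \<le> i \<and> 2 \<le> j")
    case True
    then obtain i' j' where "i = Suc (Suc i')" "j = Suc (Suc j')"
      by (metis One_nat_def Suc_1 Suc_le_D Suc_le_mono)
    then show ?thesis
      by (auto simp: occ_23_1_def prepend_def image_iff)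
  next
    case False
    then consider "i = 0" | "j < 2" | "i = 1" "2 \<le> j" by fastforce
    then show ?thesis
    proof cases
      case 3
      then obtain j' where "j = Suc (Suc j')"
        by (metis One_nat_def Suc_1 Suc_le_D Suc_le_mono)
      with 3 n show ?thesis
        by (auto simp: occ_23_1_def prepend_def image_iff skip_def)
    qed (auto simp: occ_23_1_def)
  qed
  then show ?thesis by auto
qed

text \<open>If \<open>a < q 1\<close>, none of the \<open>a\<close> smaller letters is
  \<open>q 1\<close>, so all of them stand far enough right to close one new occurrence
  each.\<close>

lemma card_occ_23_1_prepend:
  assumes q: "q permutes {1..n}" and n: "1 \<le> n" and a: "a \<le> n"
  shows "card (occ_23_1 (Suc n) (prepend n a q)) =
    card (occ_23_1 n q) + (if a < q 1 then a else 0)"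
proof -
  have shift: "card ((\<lambda>(i, j). (Suc i, Suc j)) ` occ_23_1 n q) = card (occ_23_1 n q)"
    by (intro card_image) (auto simp: inj_on_def)
  show ?thesis
  proof (cases "a < q 1")
    case True
    have "q ` {j \<in> {2..n}. q j \<le> a} = {1..a}"
    proof (intro equalityI subsetI)
      fix x assume "x \<in> q ` {j \<in> {2..n}. q j \<le> a}"
      then obtain j where "j \<in> {2..n}" "x = q j" "q j \<le> a" by auto
      then show "x \<in> {1..a}"
        using permutes_in_image[OF q, of j] by auto
    next
      fix x assume x: "x \<in> {1..a}"
      then have "x \<in> q ` {1..n}"
        using permutes_image[OF q] a by auto
      then obtain j where j: "j \<in> {1..n}" "x = q j" by auto
      with x True have "j \<noteq> 1" by auto
      with j x show "x \<in> q ` {j \<in> {2..n}. q j \<le> a}" by auto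
    qed
    then have "card {j \<in> {2..n}. q j \<le> a} = a"
      using card_image[of q "{j \<in> {2..n}. q j \<le> a}"] permutes_inj_on[OF q] by simp
    then have "card ({1::nat} \<times> (Suc ` {j \<in> {2..n}. q j \<le> a})) = a"
      by (simp add: card_cartesian_product card_image)
    moreover have "(\<lambda>(i, j). (Suc i, Suc j)) ` occ_23_1 n q \<inter>
        {1} \<times> (Suc ` {j \<in> {2..n}. q j \<le> a}) = {}"
      by (auto simp: occ_23_1_def)
    ultimately show ?thesis
      using True shift finite_occ_23_1
      by (simp add: occ_23_1_prepend[OF n] card_Un_disjoint del: One_nat_def)
  qed (simp add: occ_23_1_prepend[OF n] shift)
qed

section \<open>Counting by the first letter\<close>

lemma card_split_first_letter:
  assumes n: "1 \<le> n" and A: "A \<subseteq> {..<n}"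
  shows "card {q. q permutes {1..n} \<and> card (occ_23_1 n q) = r \<and> q 1 - 1 \<in> A} = (\<Sum>b\<in>A. w r n b)"
proof -
  let ?S = "\<lambda>b. {q. q permutes {1..n} \<and> card (occ_23_1 n q) = r \<and> q 1 = Suc b}"
  have "1 \<le> q 1" if "q permutes {1..n}" for q
    using permutes_in_image[OF that, of 1] n by auto
  then have "{q. q permutes {1..n} \<and> card (occ_23_1 n q) = r \<and> q 1 - 1 \<in> A} = (\<Union>b\<in>A. ?S b)"
    by (force simp: Suc_le_eq gr0_conv_Suc)
  moreover have "card (\<Union>b\<in>A. ?S b) = (\<Sum>b\<in>A. card (?S b))"
  proof (intro card_UN_disjoint ballI impI)
    show "finite A" using A finite_subset by blast
    show "finite (?S b)" for b
      by (rule finite_subset[OF _ finite_permutations[of "{1..n}"]]) auto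
  qed auto
  ultimately show ?thesis by (simp add: w_def)
qed

lemma v_eq_sum_w:
  assumes n: "1 \<le> n"
  shows "v r n = (\<Sum>b<n. w r n b)"
proof -
  have "q 1 - 1 < n" if "q permutes {1..n}" for q
    using permutes_in_image[OF that, of 1] n by auto
  then have "{q. q permutes {1..n} \<and> card (occ_23_1 n q) = r} =
      {q. q permutes {1..n} \<and> card (occ_23_1 n q) = r \<and> q 1 - 1 \<in> {..<n}}"
    by auto
  then show ?thesis
    using card_split_first_letter[OF n order_refl, of r] by (simp only: v_def)
qed

text \<open>The sums run over the first letter \<open>Suc b\<close> of the shortened word:
  \<open>b < a\<close> means a descent, which costs nothing, and \<open>b >= a\<close> an ascent,
  which accounts for \<open>a\<close> occurrences. The guard \<open>a <= r\<close> excludes a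
  truncated \<open>r - a\<close>.\<close>

lemma w_Suc:
  assumes n: "1 \<le> n" and a: "a \<le> n"
  shows "w r (Suc n) a =
    (\<Sum>b<a. w r n b) + (if a \<le> r then \<Sum>b\<in>{a..<n}. w (r - a) n b else 0)"
proof -
  let ?Q = "{q. q permutes {1..n}}"
  let ?D = "{q \<in> ?Q. card (occ_23_1 n q) = r \<and> q 1 - 1 \<in> {..<a}}"
  let ?A = "{q \<in> ?Q. card (occ_23_1 n q) + a = r \<and> q 1 - 1 \<in> {a..<n}}"
  have q1: "1 \<le> q 1 \<and> q 1 \<le> n" if "q permutes {1..n}" for q
    using permutes_in_image[OF that, of 1] n by auto
  have img: "prepend n a ` ?Q = {p. p permutes {1..Suc n} \<and> p 1 = Suc a}"
    and inj: "inj_on (prepend n a) ?Q"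
    using bij_betw_prepend[OF a] by (auto simp: bij_betw_def)
  have "{p. p permutes {1..Suc n} \<and> card (occ_23_1 (Suc n) p) = r \<and> p 1 = Suc a} =
      {p \<in> prepend n a ` ?Q. card (occ_23_1 (Suc n) p) = r}"
    unfolding img by auto
  also have "\<dots> = prepend n a ` {q \<in> ?Q. card (occ_23_1 (Suc n) (prepend n a q)) = r}"
    by auto
  also have "{q \<in> ?Q. card (occ_23_1 (Suc n) (prepend n a q)) = r} = ?D \<union> ?A"
  proof -
    have "card (occ_23_1 (Suc n) (prepend n a q)) = r \<longleftrightarrow> q \<in> ?D \<union> ?A" if "q \<in> ?Q" for q
      using that q1[of q] card_occ_23_1_prepend[of q n a] n a by auto
    then show ?thesis by blast
  qed
  finally have "w r (Suc n) a = card (prepend n a ` (?D \<union> ?A))"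
    by (simp add: w_def del: One_nat_def)
  also have "\<dots> = card (?D \<union> ?A)"
    by (intro card_image inj_on_subset[OF inj]) auto
  also have "\<dots> = card ?D + card ?A"
    by (intro card_Un_disjoint finite_subset[OF _ finite_permutations[of "{1..n}"]]) auto
  also have "card ?D = (\<Sum>b<a. w r n b)"
    using card_split_first_letter[OF n, of "{..<a}" r] a by (simp del: One_nat_def)
  also have "card ?A = (if a \<le> r then \<Sum>b\<in>{a..<n}. w (r - a) n b else 0)"
  proof (cases "a \<le> r")
    case True
    then have "?A = {q. q permutes {1..n} \<and> card (occ_23_1 n q) = r - a \<and> q 1 - 1 \<in> {a..<n}}"
      by auto
    moreover have "{a..<n} \<subseteq> {..<n}"
      by auto
    ultimately show ?thesis
      using True card_split_first_letter[OF n, of "{a..<n}" "r - a"] by (simp only: if_True)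
  qed auto
  finally show ?thesis .
qed

lemma v_small:
  assumes "n \<le> 2"
  shows "v r n = (if r = 0 then fact n else 0)"
proof -
  have occ: "occ_23_1 n p = {}" for p
    using assms by (auto simp: occ_23_1_def)
  show ?thesis
    using card_permutations[of "{1..n}" n] by (simp add: v_def occ)
qed

text \<open>A leading 1 has no smaller letter, so deleting it keeps every occurrence.\<close>

lemma w_first_0: "w r (Suc n) 0 = v r n"
proof (cases "n = 0")
  case True
  then show ?thesis
    by (simp add: w_def v_def occ_23_1_def conj_commute cong: conj_cong)
next
  case False
  then show ?thesis
    using w_Suc[of n 0 r] v_eq_sum_w[of n r] by (simp add: lessThan_atLeast0)
qed

text \<open>After a leading 2 an ascent would form an occurrence with the letter 1. So 1 comes
  second, and both letters can be deleted.\<close>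

lemma w_first_1:
  assumes "1 \<le> n"
  shows "w 0 (Suc n) 1 = v 0 (n - 1)"
  using assms w_Suc[of n 1 0] w_first_0[of 0 "n - 1"] by simp

section \<open>Solving the recursion\<close>

text \<open>The operator \<open>(1 + S)^c\<close>, where \<open>S\<close> delays a sequence by one
  index. From \<open>sum_w_2\<close> on, \<open>c <= m\<close> holds, so \<open>m - k\<close> is not
  truncated there.\<close>

definition binom_trans :: "nat \<Rightarrow> (nat \<Rightarrow> 'a) \<Rightarrow> nat \<Rightarrow> 'a::comm_ring_1" where
  "binom_trans c f m = (\<Sum>k\<le>c. of_nat (c choose k) * f (m - k))"

lemma binom_trans_0 [simp]: "binom_trans 0 f m = f m"
  by (simp add: binom_trans_def)

text \<open>Pascal's rule for the binomial coefficients. The partial sums of \<open>w 2\<close> obey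
  the same recursion, apart from source terms.\<close>

lemma binom_trans_Suc_Suc:
  "binom_trans (Suc c) f (Suc m) = binom_trans c f (Suc m) + binom_trans c f m"
proof -
  have "binom_trans (Suc c) f (Suc m) =
      f (Suc m) + (\<Sum>k\<le>c. of_nat (Suc c choose Suc k) * f (m - k))"
    by (simp add: binom_trans_def sum.atMost_Suc_shift del: sum.atMost_Suc)
  also have "\<dots> = (f (Suc m) + (\<Sum>k\<le>c. of_nat (c choose Suc k) * f (Suc m - Suc k))) + binom_trans c f m"
    by (simp add: binom_trans_def sum.distrib algebra_simps)
  also have "f (Suc m) + (\<Sum>k\<le>c. of_nat (c choose Suc k) * f (Suc m - Suc k)) =
      (\<Sum>k\<le>Suc c. of_nat (c choose k) * f (Suc m - k))"
    by (simp add: binomial_eq_0 sum.atMost_Suc_shift del: sum.atMost_Suc)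
  also have "\<dots> = binom_trans c f (Suc m)"
    by (simp add: binom_trans_def binomial_eq_0)
  finally show ?thesis .
qed

lemma binom_trans_diff:
  "binom_trans c (\<lambda>m. f m - g m) m = binom_trans c f m - binom_trans c g m"
  by (simp add: binom_trans_def algebra_simps sum_subtractf)

lemma binom_trans_shift:
  "j \<le> m \<Longrightarrow> binom_trans c (\<lambda>m. f (m - j)) m = binom_trans c f (m - j)"
  by (simp add: binom_trans_def add.commute)

abbreviation vr :: "nat \<Rightarrow> nat \<Rightarrow> rat" where
  "vr r n \<equiv> of_nat (v r n)"

text \<open>For \<open>m >= 1\<close>, the number of permutations with one occurrence and first
  letter at least 2: the words left when a 2 followed by an ascent is deleted.\<close>

definition source1 :: "nat \<Rightarrow> rat" where
  "source1 m = vr 1 m - vr 1 (m - 1)"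

text \<open>For \<open>m >= 2\<close>, the number of avoiding permutations with first letter at
  least 3: the words left when a 3 followed by an ascent is deleted.\<close>

definition source2 :: "nat \<Rightarrow> rat" where
  "source2 m = vr 0 m - vr 0 (m - 1) - vr 0 (m - 2)"

text \<open>An ascent after \<open>Suc a\<close> uses up \<open>a\<close> of the two occurrences, so
  ascents contribute only for \<open>a <= 2\<close>.\<close>

lemma w_2_Suc:
  assumes "1 \<le> n" "1 \<le> a" "a \<le> n"
  shows "(of_nat (w 2 (Suc n) a) :: rat) = (\<Sum>b<a. of_nat (w 2 n b)) +
    (if a = 1 then source1 n else 0) + (if a = 2 then source2 n else 0)"
proof -
  obtain n' where n': "n = Suc n'"
    using assms by (cases n) auto
  consider "a = 1" | "a = 2" | "3 \<le> a"
    using assms by fastforce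
  then show ?thesis
  proof cases
    case 1
    have "v 1 n = w 1 n 0 + (\<Sum>b\<in>{1..<n}. w 1 n b)"
      using v_eq_sum_w[of n 1] assms by (simp add: lessThan_atLeast0 sum.atLeast_Suc_lessThan)
    then have "v 1 n = v 1 (n - 1) + (\<Sum>b\<in>{1..<n}. w 1 n b)"
      by (simp add: n' w_first_0)
    then have "source1 n = (\<Sum>b\<in>{1..<n}. of_nat (w 1 n b))"
      by (simp add: source1_def)
    with 1 show ?thesis
      using w_Suc[of n a 2] assms by simp
  next
    case 2
    have "v 0 n = w 0 n 0 + (w 0 n 1 + (\<Sum>b\<in>{2..<n}. w 0 n b))"
      using v_eq_sum_w[of n 0] assms 2
      by (simp add: lessThan_atLeast0 sum.atLeast_Suc_lessThan numeral_2_eq_2)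
    then have "v 0 n = v 0 (n - 1) + (v 0 (n - 2) + (\<Sum>b\<in>{2..<n}. w 0 n b))"
      using w_first_1[of n'] assms 2 by (simp add: n' w_first_0 numeral_2_eq_2)
    then have "source2 n = (\<Sum>b\<in>{2..<n}. of_nat (w 0 n b))"
      by (simp add: source2_def)
    with 2 show ?thesis
      using w_Suc[of n a 2] assms by simp
  next
    case 3
    then show ?thesis
      using w_Suc[of n a 2] assms by simp
  qed
qed

text \<open>Raising \<open>c\<close> by one adds the partial sum up to \<open>c\<close> for the next
  shorter length, which is Pascal's recursion. A source entering at \<open>a\<close> undergoes only
  the remaining \<open>c - a\<close> steps.\<close>

lemma sum_w_2:
  assumes "c \<le> n"
  shows "(\<Sum>a<Suc c. of_nat (w 2 (Suc n) a)) = binom_trans c (vr 2) n +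
    (if 1 \<le> c then binom_trans (c - 1) source1 n else 0) +
    (if 2 \<le> c then binom_trans (c - 2) source2 n else 0)"
  using assms
proof (induction c arbitrary: n)
  case 0
  then show ?case by (simp add: w_first_0)
next
  case (Suc c)
  then obtain m where m: "n = Suc m" "c \<le> m"
    by (cases n) auto
  have w: "(of_nat (w 2 (Suc n) (Suc c)) :: rat) = (\<Sum>b<Suc c. of_nat (w 2 (Suc m) b)) +
      (if Suc c = 1 then source1 n else 0) + (if Suc c = 2 then source2 n else 0)"
    using w_2_Suc[of n "Suc c"] Suc.prems m by simp
  have "(\<Sum>a<Suc (Suc c). of_nat (w 2 (Suc n) a)) =
      (\<Sum>a<Suc c. of_nat (w 2 (Suc n) a)) + (of_nat (w 2 (Suc n) (Suc c)) :: rat)"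
    by (rule sum.lessThan_Suc)
  note eq = this[unfolded w Suc.IH[OF m(2)] Suc.IH[OF Suc_leD[OF Suc.prems]]]
  \<comment> \<open>For \<open>c = 0\<close> and \<open>c = 1\<close> a source enters at this very
    step; from 2 on Pascal's rule acts on all three terms.\<close>
  consider "c = 0" | "c = 1" | d where "c = Suc (Suc d)"
    by (metis One_nat_def not0_implies_Suc)
  then show ?case
    unfolding eq
    by cases (simp_all add: m binom_trans_Suc_Suc)
qed

lemma v_2_recurrence:
  fixes n :: nat
  defines "B \<equiv> (\<lambda>r n. binom_trans n (vr r) n)"
  assumes "2 \<le> n"
  shows "vr 2 (Suc n) =
    B 2 n + (B 1 n - 2 * B 1 (n - 1)) + (B 0 n - 3 * B 0 (n - 1) + B 0 (n - 2))"
proof -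
  obtain m where n: "n = Suc (Suc m)"
    using assms(2) by (metis Suc_1 Suc_le_D Suc_le_mono One_nat_def)
  have "vr 2 (Suc n) = (\<Sum>a<Suc n. of_nat (w 2 (Suc n) a))"
    using v_eq_sum_w[of "Suc n" 2] by (simp del: sum.lessThan_Suc)
  also have "\<dots> = B 2 n + binom_trans (n - 1) source1 n + binom_trans (n - 2) source2 n"
    using sum_w_2[of n n] assms(2) by (simp add: B_def)
  \<comment> \<open>Pascal's rule read backwards turns the unshifted part into
    \<open>B 1 n - B 1 (n - 1)\<close>; the shifted part removes another
    \<open>B 1 (n - 1)\<close>.\<close>
  also have "binom_trans (n - 1) source1 n = B 1 n - 2 * B 1 (n - 1)"
    unfolding source1_def binom_trans_diff
    using binom_trans_shift[of 1 n "n - 1" "vr 1"]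
    by (simp add: n B_def binom_trans_Suc_Suc)
  \<comment> \<open>Two backward steps give \<open>B 0 n - 2 * B 0 (n - 1) + B 0 (n - 2)\<close>.
    Subtracted from it are \<open>B 0 (n - 1) - B 0 (n - 2)\<close> for the shift by 1 and
    \<open>B 0 (n - 2)\<close> for the shift by 2.\<close>
  also have "binom_trans (n - 2) source2 n = B 0 n - 3 * B 0 (n - 1) + B 0 (n - 2)"
    unfolding source2_def binom_trans_diff
    using binom_trans_shift[of 1 n "n - 2" "vr 0"] binom_trans_shift[of 2 n "n - 2" "vr 0"]
    by (simp add: n B_def binom_trans_Suc_Suc)
  finally show ?thesis .
qed

section \<open>The substitution \<open>x / (1 - x)\<close>\<close>

unbundle fps_syntax

lemma fps_X_div_nth_0: "(fps_X / (1 - fps_X) :: 'a::field fps) $ 0 = 0"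
  by (simp add: fps_divide_unit)

text \<open>Multiply \<open>q = x (q + 1)\<close> by \<open>q ^ i\<close>. On coefficients this is
  Pascal's rule.\<close>

lemma fps_X_div_power_Suc:
  fixes q :: "'a::field fps"
  defines "q \<equiv> fps_X / (1 - fps_X)"
  shows "q ^ Suc i = fps_X * (q ^ Suc i + q ^ i)"
proof -
  have "q * (1 - fps_X) = fps_X * (inverse (1 - fps_X) * (1 - fps_X))"
    by (simp add: q_def fps_divide_unit mult.assoc)
  also have "\<dots> = fps_X"
    by (simp add: inverse_mult_eq_1)
  finally have q: "q = fps_X * (q + 1)"
    by (simp add: algebra_simps)
  have "q ^ Suc i = q * q ^ i"
    by simp
  also have "\<dots> = fps_X * (q + 1) * q ^ i"
    by (subst q) (rule refl)
  finally show ?thesis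
    by (simp add: algebra_simps)
qed

lemma fps_X_div_power_nth_Suc:
  "((fps_X / (1 - fps_X)) ^ Suc i :: 'a::field fps) $ Suc n = of_nat (n choose i)"
proof (induction n arbitrary: i)
  case 0
  show ?case
    by (subst fps_X_div_power_Suc) (cases i; simp add: fps_X_div_nth_0)
next
  case (Suc n)
  show ?case
  proof (cases i)
    case 0
    then show ?thesis
      using Suc.IH[of 0] by (subst fps_X_div_power_Suc) simp
  next
    case (Suc j)
    then show ?thesis
      using Suc.IH[of j] Suc.IH[of i] by (subst fps_X_div_power_Suc) (simp del: power_Suc)
  qed
qed

text \<open>The outer factor turns \<open>q * f(q)\<close> into \<open>(x f)(q)\<close>, so only the
  powers \<open>q ^ Suc i\<close> contribute, and their coefficients are binomial.\<close>

lemma fps_X_div_compose_nth_Suc: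
  fixes f :: "'a::field fps"
  defines "q \<equiv> fps_X / (1 - fps_X)"
  shows "(q * fps_compose f q) $ Suc n = binom_trans n (fps_nth f) n"
proof -
  have q0: "q $ 0 = 0"
    by (simp add: q_def fps_X_div_nth_0)
  have "(q * fps_compose f q) $ Suc n = fps_compose (fps_X * f) q $ Suc n"
    by (simp add: fps_compose_mult_distrib q0)
  also have "\<dots> = (\<Sum>i\<le>Suc n. (fps_X * f) $ i * (q ^ i) $ Suc n)"
    by (simp add: fps_compose_nth atMost_atLeast0)
  also have "\<dots> = (\<Sum>i\<le>n. f $ i * (q ^ Suc i) $ Suc n)"
    by (subst sum.atMost_Suc_shift) simp
  also have "\<dots> = (\<Sum>i\<le>n. f $ i * of_nat (n choose i))"
    by (simp only: q_def fps_X_div_power_nth_Suc)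
  also have "\<dots> = (\<Sum>k\<le>n. f $ (n - k) * of_nat (n choose (n - k)))"
    by (rule sum.reindex_bij_witness[where i = "\<lambda>k. n - k" and j = "\<lambda>k. n - k"]) auto
  also have "\<dots> = binom_trans n (fps_nth f) n"
    unfolding binom_trans_def
    by (intro sum.cong refl) (simp add: binomial_symmetric[symmetric])
  finally show ?thesis .
qed

theorem theorem5:
  shows "V 2 = fps_X / (1 - fps_X) *
      (fps_compose (V 2) (fps_X / (1 - fps_X))
       + (1 - 2 * fps_X) * fps_compose (V 1) (fps_X / (1 - fps_X))
       + (1 - 3 * fps_X + fps_X ^ 2) * fps_compose (V 0) (fps_X / (1 - fps_X)))
      - fps_X + fps_X ^ 2"
proof -
  define q :: "rat fps" where "q = fps_X / (1 - fps_X)"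
  define G where "G r = q * fps_compose (V r) q" for r
  have G0: "G r $ 0 = 0" for r
    by (simp add: G_def q_def fps_X_div_nth_0)
  have "fps_nth (V r) = vr r" for r
    by (auto simp: V_def)
  then have G_Suc: "G r $ Suc n = binom_trans n (vr r) n" for r n
    by (simp add: G_def q_def fps_X_div_compose_nth_Suc)
  \<comment> \<open>Every factor \<open>fps_X\<close> is moved to the left, where it acts as an
    index shift.\<close>
  have "V 2 = G 2 + (G 1 - fps_X * (2 * G 1)) + (G 0 - fps_X * (3 * G 0) + fps_X * (fps_X * G 0))
      - fps_X + fps_X * fps_X" (is "_ = ?R")
  proof (rule fps_ext)
    fix n
    \<comment> \<open>The recurrence starts at length 3. At 0, 1, 2 the \<open>G\<close> terms give
      0, 1, -1 while \<open>v 2 n = 0\<close>; the terms \<open>- x + x^2\<close> correct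
      this.\<close>
    consider "n = 0" | "n = 1" | "n = 2" | m where "n = Suc (Suc (Suc m))"
      by (metis One_nat_def Suc_1 not0_implies_Suc)
    then show "V 2 $ n = ?R $ n"
    proof cases
      case 4
      then show ?thesis
        using v_2_recurrence[of "Suc (Suc m)"]
        by (simp add: G_Suc V_def numeral_fps_const)
    qed (simp_all add: G0 G_Suc V_def v_small numeral_2_eq_2 binom_trans_def numeral_fps_const)
  qed
  also have "\<dots> = q * (fps_compose (V 2) q + (1 - 2 * fps_X) * fps_compose (V 1) q
      + (1 - 3 * fps_X + fps_X ^ 2) * fps_compose (V 0) q) - fps_X + fps_X ^ 2"
    by (simp add: G_def algebra_simps power2_eq_square)
  finally show ?thesis
    by (simp only: q_def)
qed

end
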